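(* Let $n\ge 2$ and $K\ge 1$ be integers, let $\varepsilon>0$, $\rho\in(0,1]$ and $\gamma\ge 0$, and let $y_1,\dots,y_K\in\mathbb{R}^{n-1}$ satisfy $\sum_{k=1}^K y_ky_k^\top\succ 0$. For real symmetric positive definite $(n-1)\times(n-1)$ matrices $\Sigma$ define $$F_\gamma(\Sigma)=\frac{1}{1+\gamma/(n-1)}\left(\frac{n-1}{K}\sum_{k=1}^K\frac{y_ky_k^\top}{y_k^\top\Sigma^{-1}y_k+\varepsilon}+\frac{\gamma}{\mathrm{tr}(\Sigma^{-1})}I\right),$$ $$\widetilde M(\Sigma)=(1-\rho)F_\gamma(\Sigma)+\rho I,\qquad M(\Sigma)=\frac{(n-1)\,\widetilde M(\Sigma)}{\mathrm{tr}(\widetilde M(\Sigma))}.$$ Then the mapping $M$ admits at least one fixed point $\Sigma_\star\succ 0$ with $\mathrm{tr}(\Sigma_\star)=n-1$, i.e. $M(\Sigma_\star)=\Sigma_\star$.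
   Context: $\succ 0$ means symmetric positive definite; $I$ is the $(n-1)\times(n-1)$ identity matrix. *)

theory Defs
  imports "HOL-Analysis.Analysis"
begin

definition sym_pos_def :: "real^'m^'m \<Rightarrow> bool" where
  "sym_pos_def A \<longleftrightarrow> transpose A = A \<and> (\<forall>x. x \<noteq> 0 \<longrightarrow> 0 < x \<bullet> (A *v x))"

definition outer_prod :: "real^'m \<Rightarrow> real^'m^'m" where
  "outer_prod y = (\<chi> i j. y $ i * y $ j)"

text \<open>In the following maps \<open>n\<close> is the number with \<open>CARD('m) = n - 1\<close>. They are meant for
  symmetric positive definite \<open>S\<close>; elsewhere \<open>matrix_inv\<close> and division by zero give them junk values.\<close>

definition F_map ::
  "nat \<Rightarrow> nat \<Rightarrow> real \<Rightarrow> real \<Rightarrow> (nat \<Rightarrow> real^'m) \<Rightarrow> real^'m^'m \<Rightarrow> real^'m^'m" where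
  "F_map n K \<epsilon> \<gamma> y S =
     (1 / (1 + \<gamma> / (real n - 1))) *\<^sub>R
       (((real n - 1) / real K) *\<^sub>R
          (\<Sum>k=1..K. (1 / (y k \<bullet> (matrix_inv S *v y k) + \<epsilon>)) *\<^sub>R outer_prod (y k))
        + (\<gamma> / trace (matrix_inv S)) *\<^sub>R mat 1)"

definition M_tilde ::
  "nat \<Rightarrow> nat \<Rightarrow> real \<Rightarrow> real \<Rightarrow> real \<Rightarrow> (nat \<Rightarrow> real^'m) \<Rightarrow> real^'m^'m \<Rightarrow> real^'m^'m" where
  "M_tilde n K \<epsilon> \<rho> \<gamma> y S = (1 - \<rho>) *\<^sub>R F_map n K \<epsilon> \<gamma> y S + \<rho> *\<^sub>R mat 1"

definition M_map ::
  "nat \<Rightarrow> nat \<Rightarrow> real \<Rightarrow> real \<Rightarrow> real \<Rightarrow> (nat \<Rightarrow> real^'m) \<Rightarrow> real^'m^'m \<Rightarrow> real^'m^'m" where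
  "M_map n K \<epsilon> \<rho> \<gamma> y S =
     ((real n - 1) / trace (M_tilde n K \<epsilon> \<rho> \<gamma> y S)) *\<^sub>R M_tilde n K \<epsilon> \<rho> \<gamma> y S"

end

theory Submission
  imports Defs
begin

text \<open>Brouwer's theorem is applied to the compact convex set of symmetric matrices \<open>S\<close> with
  \<open>S \<ge> c I\<close> and trace \<open>d = n - 1\<close>. The shrinkage term keeps \<open>M_tilde\<close> above \<open>\<rho> I\<close>. Its trace is
  bounded by a constant \<open>B\<close> on all positive definite matrices of trace \<open>d\<close>, because \<open>\<epsilon> > 0\<close> bounds
  the rank-one terms and \<open>trace S = d\<close> forces \<open>trace (S\<^sup>-\<^sup>1) \<ge> 1\<close>. As \<open>B\<close> does not depend on \<open>c\<close>, the
  choice \<open>c = \<rho> d / B\<close> makes the set invariant.\<close>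

text \<open>The uniform bound \<open>c\<close> replaces strict positivity: a non-strict inequality
  survives limits, so the set is closed, and for \<open>c > 0\<close> it also bounds the inverses
  uniformly. All conditions are affine in \<open>S\<close>, hence convexity.\<close>

definition spd_slice :: "real \<Rightarrow> real \<Rightarrow> (real^'m^'m) set" where
  "spd_slice c d = {S. transpose S = S \<and> trace S = d \<and> (\<forall>x. c * (x \<bullet> x) \<le> x \<bullet> (S *v x))}"

section \<open>Continuity and algebra of matrix action, trace, transpose and outer products\<close>

lemma linear_matrix_vector_mult_left: "linear (\<lambda>A :: real^'m^'k. A *v x)"
  by (rule linearI) (simp_all add: matrix_vector_mult_add_rdistrib scaleR_matrix_vector_assoc)

lemma continuous_on_matrix_vector_mult_left [continuous_intros]:
  assumes "continuous_on T f"
  shows "continuous_on T (\<lambda>s. (f s :: real^'m^'k) *v x)"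
  by (rule bounded_linear.continuous_on[OF _ assms])
    (simp add: linear_conv_bounded_linear[symmetric] linear_matrix_vector_mult_left)

lemma continuous_on_trace [continuous_intros]:
  assumes "continuous_on T f"
  shows "continuous_on T (\<lambda>s. trace (f s :: real^'m^'m))"
  unfolding trace_def by (intro continuous_intros assms)

lemma continuous_on_transpose [continuous_intros]:
  assumes "continuous_on T f"
  shows "continuous_on T (\<lambda>s. transpose (f s :: real^'m^'k))"
  unfolding transpose_def by (intro continuous_intros assms)

lemma trace_scaleR: "trace (a *\<^sub>R (A :: real^'m^'m)) = a * trace A"
  by (simp add: trace_def sum_distrib_left)

lemma trace_sum: "trace (\<Sum>k\<in>I. (f k :: real^'m^'m)) = (\<Sum>k\<in>I. trace (f k))"
  by (simp add: trace_def sum.swap[of _ I])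

lemma transpose_add: "transpose (A + B :: real^'m^'k) = transpose A + transpose B"
  by (simp add: transpose_def vec_eq_iff)

lemma transpose_sum: "transpose (\<Sum>k\<in>I. (f k :: real^'m^'k)) = (\<Sum>k\<in>I. transpose (f k))"
  by (simp add: transpose_def vec_eq_iff)

lemma sum_matrix_vector_mult: "(\<Sum>k\<in>I. (f k :: real^'m^'k)) *v x = (\<Sum>k\<in>I. f k *v x)"
  using linear_sum[OF linear_matrix_vector_mult_left] .

lemma transpose_outer_prod: "transpose (outer_prod y) = outer_prod y"
  by (simp add: transpose_def outer_prod_def vec_eq_iff mult.commute)

lemma trace_outer_prod: "trace (outer_prod y) = y \<bullet> y"
  by (simp add: trace_def outer_prod_def inner_vec_def)

lemma outer_prod_mult_vec: "outer_prod y *v x = (y \<bullet> x) *\<^sub>R y"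
  by (simp add: outer_prod_def matrix_vector_mult_def inner_vec_def vec_eq_iff sum_distrib_left
      sum_distrib_right mult_ac)

section \<open>Inverses and traces of positive definite matrices\<close>

lemma sym_pos_def_inv_mult:
  assumes "sym_pos_def S"
  shows "S *v (matrix_inv S *v x) = x"
proof -
  have "inj ((*v) S)"
    using assms unfolding sym_pos_def_def
    by (subst vec.inj_iff_eq_0) (metis inner_zero_right less_irrefl)
  then have "invertible S"
    using matrix_left_invertible_injective invertible_left_inverse by metis
  \<comment> \<open>\<open>matrix_inv\<close> is a choice of a two-sided inverse, so invertibility
    must be known before its defining property can be used.\<close>
  then show ?thesis
    unfolding invertible_def matrix_inv_def matrix_vector_mul_assoc
    by (metis (mono_tags, lifting) matrix_vector_mul_lid someI_ex)
qed

lemma sym_pos_def_imp_nonneg: "sym_pos_def S \<Longrightarrow> 0 \<le> x \<bullet> (S *v x)"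
  unfolding sym_pos_def_def by (metis inner_zero_left less_eq_real_def)

text \<open>With \<open>v = matrix_inv S *v x\<close>, so that \<open>S *v v = x\<close>, the value
  is \<open>v \<bullet> (S *v v)\<close>.\<close>

lemma sym_pos_def_inv_nonneg:
  assumes "sym_pos_def S"
  shows "0 \<le> x \<bullet> (matrix_inv S *v x)"
  using sym_pos_def_imp_nonneg[OF assms, of "matrix_inv S *v x"]
  by (simp add: sym_pos_def_inv_mult[OF assms] inner_commute)

lemma inner_axis_matrix_axis: "axis i 1 \<bullet> ((A :: real^'m^'m) *v axis j 1) = A $ i $ j"
  by (simp add: inner_axis' matrix_vector_mult_basis column_def)

lemma trace_eq_sum_inner_axis:
  "trace (A :: real^'m^'m) = (\<Sum>i\<in>UNIV. axis i 1 \<bullet> (A *v axis i 1))"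
  by (simp only: inner_axis_matrix_axis trace_def)

lemma sym_pos_def_diag_le_trace:
  assumes "sym_pos_def S"
  shows "S $ i $ i \<le> trace S"
proof -
  have "0 \<le> S $ j $ j" for j
    using sym_pos_def_imp_nonneg[OF assms, of "axis j 1"] by (simp only: inner_axis_matrix_axis)
  then show ?thesis
    unfolding trace_def by (intro member_le_sum) auto
qed

lemma symmetric_matrix_inner:
  assumes "transpose S = (S :: real^'m^'m)"
  shows "u \<bullet> (S *v v) = (S *v u) \<bullet> v"
  using dot_lmul_matrix[of u S v] assms by (metis transpose_matrix_vector)

text \<open>Expand \<open>0 \<le> w \<bullet> S w\<close> at \<open>w = S\<^sup>-\<^sup>1 e - e / d\<close> for each unit vector \<open>e\<close>.\<close>
lemma trace_inv_ge_one:
  fixes S :: "real^'m^'m"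
  assumes S: "sym_pos_def S" and tr: "trace S = real CARD('m)"
  shows "1 \<le> trace (matrix_inv S)"
proof -
  let ?d = "real CARD('m)"
  have d: "?d > 0" by simp
  have sym: "transpose S = S" using S by (simp add: sym_pos_def_def)
  have "1 / ?d \<le> axis i 1 \<bullet> (matrix_inv S *v axis i 1)" for i
  proof -
    define e :: "real^'m" where "e = axis i 1"
    define v where "v = matrix_inv S *v e"
    have Sv: "S *v v = e" by (simp add: v_def sym_pos_def_inv_mult[OF S])
    have ee: "e \<bullet> e = 1" by (simp add: e_def inner_axis_axis)
    \<comment> \<open>The trace hypothesis enters here: it will bound the quadratic term of the
      expansion by \<open>1 / d\<close>, against the cross terms \<open>- 2 / d\<close>.\<close>
    have eSe: "e \<bullet> (S *v e) \<le> ?d"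
      using sym_pos_def_diag_le_trace[OF S, of i] tr by (simp only: e_def inner_axis_matrix_axis)
    have vSe: "v \<bullet> (S *v e) = 1"
      using symmetric_matrix_inner[OF sym, of v e] Sv ee by simp
    have "0 \<le> (v - (1/?d) *\<^sub>R e) \<bullet> (S *v (v - (1/?d) *\<^sub>R e))"
      by (rule sym_pos_def_imp_nonneg[OF S])
    also have "\<dots> = v \<bullet> e - 2 / ?d + (1/?d)^2 * (e \<bullet> (S *v e))"
      by (simp add: matrix_vector_mult_diff_distrib matrix_vector_mult_scaleR Sv inner_diff_left
          inner_diff_right vSe ee power2_eq_square diff_divide_distrib)
    also have "\<dots> \<le> v \<bullet> e - 2 / ?d + (1/?d)^2 * ?d"
      using eSe by (intro add_left_mono mult_left_mono) auto
    also have "\<dots> = v \<bullet> e - 1 / ?d"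
      using d by (simp add: power2_eq_square field_simps)
    finally show ?thesis
      by (simp add: v_def e_def inner_commute)
  qed
  then have "(\<Sum>i\<in>(UNIV::'m set). 1 / ?d) \<le> trace (matrix_inv S)"
    unfolding trace_eq_sum_inner_axis by (intro sum_mono)
  then show ?thesis by simp
qed

section \<open>Geometry of the slice and continuity of inversion on it\<close>

lemma spd_slice_sym_pos_def:
  assumes "c > 0" and "S \<in> spd_slice c d"
  shows "sym_pos_def S"
  unfolding sym_pos_def_def
proof (intro conjI allI impI)
  show "transpose S = S" using assms by (simp add: spd_slice_def)
  fix x :: "real^'a" assume "x \<noteq> 0"
  then have "0 < c * (x \<bullet> x)" using assms by simp
  also have "\<dots> \<le> x \<bullet> (S *v x)" using assms by (simp add: spd_slice_def)
  finally show "0 < x \<bullet> (S *v x)" .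
qed

lemma convex_spd_slice: "convex (spd_slice c d)"
proof (rule convexI)
  fix S T :: "real^'m^'m" and u v :: real
  assume S: "S \<in> spd_slice c d" and T: "T \<in> spd_slice c d"
    and uv: "0 \<le> u" "0 \<le> v" "u + v = 1"
  have "c * (x \<bullet> x) \<le> x \<bullet> ((u *\<^sub>R S + v *\<^sub>R T) *v x)" for x
  proof -
    have "c * (x \<bullet> x) = u * (c * (x \<bullet> x)) + v * (c * (x \<bullet> x))"
      using uv by (metis distrib_right mult_1)
    also have "\<dots> \<le> u * (x \<bullet> (S *v x)) + v * (x \<bullet> (T *v x))"
      using S T uv by (intro add_mono mult_left_mono) (auto simp: spd_slice_def)
    finally show ?thesis
      by (simp add: matrix_vector_mult_add_rdistrib scaleR_matrix_vector_assoc[symmetric]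
          inner_add_right)
  qed
  moreover have "u * d + v * d = d"
    using uv by (metis distrib_right mult_1)
  ultimately show "u *\<^sub>R S + v *\<^sub>R T \<in> spd_slice c d"
    using S T by (simp add: spd_slice_def transpose_add transpose_scalar trace_add trace_scaleR)
qed

lemma compact_spd_slice:
  assumes "c > 0"
  shows "compact (spd_slice c d :: (real^'m^'m) set)"
  unfolding compact_eq_bounded_closed
proof
  have "closed ({S. transpose S = S} \<inter> {S. trace S = d} \<inter>
      (\<Inter>x. {S :: real^'m^'m. c * (x \<bullet> x) \<le> x \<bullet> (S *v x)}))"
    by (intro closed_Int closed_INT ballI closed_Collect_eq closed_Collect_le continuous_intros)
  also have "\<dots> = spd_slice c d" by (auto simp: spd_slice_def)
  finally show "closed (spd_slice c d :: (real^'m^'m) set)" .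
  have entry: "\<bar>S $ i $ j\<bar> \<le> d" if "S \<in> spd_slice c d" for S :: "real^'m^'m" and i j
  proof -
    have S: "sym_pos_def S" using spd_slice_sym_pos_def[OF assms that] .
    have tr: "trace S = d" and sym: "transpose S = S" using that by (auto simp: spd_slice_def)
    have "S $ j $ i = S $ i $ j" using sym by (metis transpose_def vec_lambda_beta)
    \<comment> \<open>Testing the form on the sum and the difference of two unit vectors bounds an
      off-diagonal entry in absolute value by the mean of two diagonal ones, each at most the
      trace.\<close>
    then have "0 \<le> S $ i $ i + 2 * S $ i $ j + S $ j $ j"
      and "0 \<le> S $ i $ i - 2 * S $ i $ j + S $ j $ j"
      using sym_pos_def_imp_nonneg[OF S, of "axis i 1 + axis j 1"]
        sym_pos_def_imp_nonneg[OF S, of "axis i 1 - axis j 1"]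
      by (simp_all only: matrix_vector_mult_diff_distrib matrix_vector_right_distrib
          inner_diff_left inner_diff_right inner_add_left inner_add_right inner_axis_matrix_axis)
    with sym_pos_def_diag_le_trace[OF S, of i] sym_pos_def_diag_le_trace[OF S, of j] tr
    show ?thesis by linarith
  qed
  have "norm S \<le> (\<Sum>i\<in>(UNIV::'m set). \<Sum>j\<in>(UNIV::'m set). d)" if "S \<in> spd_slice c d" for S :: "real^'m^'m"
  proof -
    have "norm S \<le> (\<Sum>i\<in>UNIV. norm (S $ i))"
      unfolding norm_vec_def by (rule L2_set_le_sum) simp
    also have "\<dots> \<le> (\<Sum>i\<in>UNIV. \<Sum>j\<in>UNIV. \<bar>S $ i $ j\<bar>)"
      by (intro sum_mono norm_le_l1_cart)
    also have "\<dots> \<le> (\<Sum>i\<in>(UNIV::'m set). \<Sum>j\<in>(UNIV::'m set). d)"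
      using entry[OF that] by (intro sum_mono)
    finally show ?thesis .
  qed
  then show "bounded (spd_slice c d :: (real^'m^'m) set)"
    by (rule boundedI)
qed

text \<open>With \<open>w = matrix_inv T *v z\<close>, the lower bound on the form and
  Cauchy-Schwarz give \<open>c * (w \<bullet> w) \<le> w \<bullet> z \<le> norm w * norm z\<close>;
  cancel \<open>norm w\<close>. The bound is uniform over the slice.\<close>

lemma spd_slice_norm_inv_le:
  assumes "c > 0" and T: "T \<in> spd_slice c d"
  shows "norm (matrix_inv T *v z) \<le> norm z / c"
proof -
  let ?w = "matrix_inv T *v z"
  have "c * (?w \<bullet> ?w) \<le> ?w \<bullet> z"
    using T sym_pos_def_inv_mult[OF spd_slice_sym_pos_def[OF assms], of z]
    unfolding spd_slice_def by (metis (mono_tags, lifting) mem_Collect_eq)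
  also have "\<dots> \<le> norm ?w * norm z" by (rule norm_cauchy_schwarz)
  finally have "norm ?w * (c * norm ?w) \<le> norm ?w * norm z"
    by (simp add: dot_square_norm power2_eq_square mult_ac)
  then have "c * norm ?w \<le> norm z"
    by (cases "norm ?w = 0") (auto simp: mult_le_cancel_left)
  then show ?thesis using assms by (simp add: field_simps)
qed

text \<open>By the resolvent identity, the difference of the inverses of \<open>T\<close> and
  \<open>S\<close> applied to \<open>z\<close> is the inverse of \<open>T\<close> applied to
  \<open>(S - T) *v v\<close>, where \<open>v = matrix_inv S *v z\<close> is fixed. The uniform
  bound \<open>1 / c\<close> then lets it vanish as \<open>T\<close> tends to
  \<open>S\<close>.\<close>

lemma continuous_on_matrix_inv_mult:
  assumes "c > 0"
  shows "continuous_on (spd_slice c d) (\<lambda>S. matrix_inv S *v z)"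
  unfolding continuous_on_def
proof
  fix S :: "real^'a^'a" assume S: "S \<in> spd_slice c d"
  let ?v = "matrix_inv S *v z"
  have le: "norm (matrix_inv T *v z - ?v) \<le> norm (S *v ?v - T *v ?v) / c"
    if T: "T \<in> spd_slice c d" for T
  proof -
    have spd: "sym_pos_def T" using spd_slice_sym_pos_def[OF assms T] .
    have "T *v (matrix_inv T *v z - ?v) = S *v ?v - T *v ?v"
      by (simp add: matrix_vector_mult_diff_distrib sym_pos_def_inv_mult[OF spd]
          sym_pos_def_inv_mult[OF spd_slice_sym_pos_def[OF assms S]])
    \<comment> \<open>Injectivity of \<open>T\<close> turns the right inverse into a left
      inverse.\<close>
    moreover have "matrix_inv T *v (T *v x) = x" for x
    proof -
      have "T *v (matrix_inv T *v (T *v x) - x) = 0"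
        by (simp add: matrix_vector_mult_diff_distrib sym_pos_def_inv_mult[OF spd])
      then show ?thesis
        using spd unfolding sym_pos_def_def by (metis eq_iff_diff_eq_0 inner_zero_right less_irrefl)
    qed
    ultimately show ?thesis
      using spd_slice_norm_inv_le[OF assms T, of "S *v ?v - T *v ?v"] by metis
  qed
  have "continuous_on UNIV (\<lambda>T. norm (S *v ?v - T *v ?v) / c)"
    by (intro continuous_intros) (use assms in auto)
  then have "((\<lambda>T. norm (S *v ?v - T *v ?v) / c) \<longlongrightarrow> norm (S *v ?v - S *v ?v) / c)
      (at S within spd_slice c d)"
    unfolding continuous_on_def by (meson UNIV_I subset_UNIV tendsto_within_subset)
  then have lim: "((\<lambda>T. norm (S *v ?v - T *v ?v) / c) \<longlongrightarrow> 0) (at S within spd_slice c d)"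
    by simp
  have "((\<lambda>T. matrix_inv T *v z - ?v) \<longlongrightarrow> 0) (at S within spd_slice c d)"
    by (rule Lim_null_comparison[OF _ lim]) (auto simp: eventually_at_filter le)
  then show "((\<lambda>T. matrix_inv T *v z) \<longlongrightarrow> ?v) (at S within spd_slice c d)"
    by (rule LIM_zero_cancel)
qed

lemma continuous_on_trace_matrix_inv:
  assumes "c > 0"
  shows "continuous_on (spd_slice c d) (\<lambda>S. trace (matrix_inv S))"
  unfolding trace_eq_sum_inner_axis
  by (intro continuous_intros continuous_on_matrix_inv_mult assms)

section \<open>Trace bounds, invariance of the slice and the fixed point\<close>

theorem theorem3:
  fixes n K :: nat and \<epsilon> \<rho> \<gamma> :: real and y :: "nat \<Rightarrow> real^'m"
  assumes "n \<ge> 2" and "CARD('m) = n - 1" and "K \<ge> 1"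
    and "\<epsilon> > 0" and "0 < \<rho>" and "\<rho> \<le> 1" and "\<gamma> \<ge> 0"
    and "sym_pos_def (\<Sum>k=1..K. outer_prod (y k))"
  shows "\<exists>S :: real^'m^'m. sym_pos_def S \<and> trace S = real n - 1 \<and> M_map n K \<epsilon> \<rho> \<gamma> y S = S"
proof -
  define d where "d = real CARD('m)"
  have n: "real n - 1 = d" using assms(1,2) by (simp add: d_def)
  have d: "d > 0" by (simp add: d_def)
  define a where "a = 1 / (1 + \<gamma> / d)"
  have a: "0 \<le> a" "a \<le> 1" using d assms(7) by (auto simp: a_def divide_le_eq_1 add_pos_nonneg)
  define w where "w S k = 1 / (y k \<bullet> (matrix_inv S *v y k) + \<epsilon>)" for S k
  define b where "b S = \<gamma> / trace (matrix_inv S)" for S :: "real^'m^'m"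
  define F where "F = F_map n K \<epsilon> \<gamma> y"
  define Mt where "Mt = M_tilde n K \<epsilon> \<rho> \<gamma> y"
  define M where "M = M_map n K \<epsilon> \<rho> \<gamma> y"
  have F: "F S = a *\<^sub>R ((d / real K) *\<^sub>R (\<Sum>k=1..K. w S k *\<^sub>R outer_prod (y k)) + b S *\<^sub>R mat 1)" for S
    by (simp add: F_def F_map_def n a_def w_def b_def)
  have Mt: "Mt S = (1 - \<rho>) *\<^sub>R F S + \<rho> *\<^sub>R mat 1" for S
    by (simp add: Mt_def M_tilde_def F_def)
  have M: "M S = (d / trace (Mt S)) *\<^sub>R Mt S" for S
    by (simp add: M_def M_map_def Mt_def n)
  \<comment> \<open>The three summands bound the trace contributions of the rank-one terms (weights
    at most \<open>1 / \<epsilon>\<close>), of \<open>b S *\<^sub>R mat 1\<close> (with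
    \<open>b S \<le> \<gamma>\<close>) and of the shrinkage term. The factors \<open>a\<close> and
    \<open>1 - \<rho>\<close> are at most 1 and are dropped.\<close>
  define B where "B = d / real K * (\<Sum>k=1..K. (y k \<bullet> y k) / \<epsilon>) + \<gamma> * d + \<rho> * d"
  \<comment> \<open>Normalising multiplies the lower bound \<open>\<rho>\<close> on the form of
    \<open>Mt S\<close> by \<open>d / trace (Mt S)\<close>, which is at least
    \<open>d / B\<close>.\<close>
  define c where "c = \<rho> * d / B"
  have "0 \<le> d / real K * (\<Sum>k=1..K. (y k \<bullet> y k) / \<epsilon>)"
    using d assms(4) by (intro mult_nonneg_nonneg sum_nonneg) auto
  then have B\<rho>: "\<rho> * d \<le> B" using d assms(7) by (simp add: B_def)
  have \<rho>d: "0 < \<rho> * d" using assms(5) d by simp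
  have B: "B > 0" using B\<rho> \<rho>d by linarith
  have c: "c > 0" "c \<le> 1" using B\<rho> \<rho>d B by (auto simp: c_def)

  have w_bounds: "0 \<le> w S k" "w S k \<le> 1 / \<epsilon>" if "sym_pos_def S" for S k
    using sym_pos_def_inv_nonneg[OF that, of "y k"] assms(4)
    by (auto simp: w_def intro!: divide_left_mono)
  have b_bounds: "0 \<le> b S" "b S \<le> \<gamma>" if "sym_pos_def S" "trace S = d" for S
    using trace_inv_ge_one[of S] that assms(7)
    by (auto simp: b_def d_def divide_le_eq mult_le_cancel_left1)
  have F_sym: "transpose (F S) = F S" for S
    by (simp add: F transpose_add transpose_scalar transpose_sum transpose_outer_prod transpose_mat)
  have F_nonneg: "0 \<le> x \<bullet> (F S *v x)" if "sym_pos_def S" "trace S = d" for S x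
  proof -
    have "x \<bullet> (F S *v x) = a * (d / real K * (\<Sum>k=1..K. w S k * (y k \<bullet> x)^2) + b S * (x \<bullet> x))"
      by (simp add: F matrix_vector_mult_add_rdistrib scaleR_matrix_vector_assoc[symmetric]
          sum_matrix_vector_mult outer_prod_mult_vec inner_add_right inner_sum_right
          power2_eq_square inner_commute mult.assoc)
    also have "\<dots> \<ge> 0"
      using a d w_bounds[OF that(1)] b_bounds[OF that]
      by (intro mult_nonneg_nonneg add_nonneg_nonneg sum_nonneg) auto
    finally show ?thesis .
  qed
  have F_trace: "0 \<le> trace (F S)" "trace (F S) \<le> B - \<rho> * d" if "sym_pos_def S" "trace S = d" for S
  proof -
    show "0 \<le> trace (F S)"
      unfolding trace_eq_sum_inner_axis using F_nonneg[OF that] by (intro sum_nonneg)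
    define t where "t = d / real K * (\<Sum>k=1..K. w S k * (y k \<bullet> y k)) + b S * d"
    have "trace (F S) = a * t"
      by (simp add: F t_def trace_scaleR trace_add trace_sum trace_outer_prod trace_I d_def)
    also have "\<dots> \<le> t"
    proof -
      have "0 \<le> t"
        unfolding t_def using d w_bounds[OF that(1)] b_bounds[OF that]
        by (intro mult_nonneg_nonneg add_nonneg_nonneg sum_nonneg) auto
      then show ?thesis using a by (simp add: mult_left_le_one_le)
    qed
    also have "\<dots> \<le> d / real K * (\<Sum>k=1..K. 1 / \<epsilon> * (y k \<bullet> y k)) + \<gamma> * d"
      unfolding t_def using d w_bounds[OF that(1)] b_bounds[OF that]
      by (intro add_mono mult_left_mono mult_right_mono sum_mono) auto
    finally show "trace (F S) \<le> B - \<rho> * d" by (simp add: B_def)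
  qed
  have Mt_trace: "\<rho> * d \<le> trace (Mt S)" "trace (Mt S) \<le> B" if "sym_pos_def S" "trace S = d" for S
  proof -
    have tr: "trace (Mt S) = (1 - \<rho>) * trace (F S) + \<rho> * d"
      by (simp add: Mt trace_add trace_scaleR trace_I d_def)
    have "0 \<le> (1 - \<rho>) * trace (F S)" "(1 - \<rho>) * trace (F S) \<le> trace (F S)"
      using F_trace(1)[OF that] assms(5,6) by (auto simp: mult_left_le_one_le)
    then show "\<rho> * d \<le> trace (Mt S)" "trace (Mt S) \<le> B"
      using tr F_trace(2)[OF that] by linarith+
  qed

  let ?D = "spd_slice c d :: (real^'m^'m) set"
  have D: "sym_pos_def S" "trace S = d" if "S \<in> ?D" for S
    using spd_slice_sym_pos_def[OF c(1) that] that by (auto simp: spd_slice_def)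
  \<comment> \<open>The identity has trace \<open>d\<close> and meets the lower bound because
    \<open>c \<le> 1\<close>, which is where \<open>\<rho> * d \<le> B\<close> matters.\<close>
  have "mat 1 \<in> ?D"
    using c by (auto simp: spd_slice_def transpose_mat trace_I d_def mult_left_le_one_le)
  then have "?D \<noteq> {}" by blast
  \<comment> \<open>Each denominator stays away from zero on the slice: the weights have at least
    \<open>\<epsilon>\<close>, \<open>b\<close> has a trace at least 1, and the normalisation has at
    least \<open>\<rho> * d\<close>.\<close>
  moreover have "continuous_on ?D M"
  proof -
    have "continuous_on ?D (\<lambda>S. w S k)" for k
      unfolding w_def
      using sym_pos_def_inv_nonneg[OF D(1), of _ "y k"] assms(4)
      by (intro continuous_intros continuous_on_matrix_inv_mult c) (smt (verit))
    moreover have "continuous_on ?D b"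
      unfolding b_def using trace_inv_ge_one[OF D(1)] D(2)
      by (intro continuous_intros continuous_on_trace_matrix_inv c) (force simp: d_def)
    ultimately have "continuous_on ?D Mt"
      unfolding Mt F by (intro continuous_intros)
    then show ?thesis
      unfolding M using Mt_trace(1)[OF D] \<rho>d by (intro continuous_intros) force+
  qed
  moreover have "M \<in> ?D \<rightarrow> ?D"
  proof
    fix S assume S: "S \<in> ?D"
    have tr: "\<rho> * d \<le> trace (Mt S)" "trace (Mt S) \<le> B" using Mt_trace[OF D[OF S]] by auto
    have pos: "0 < trace (Mt S)" using tr(1) \<rho>d by linarith
    have "c * (x \<bullet> x) \<le> x \<bullet> (M S *v x)" for x
    proof -
      have "c * (x \<bullet> x) \<le> d / trace (Mt S) * \<rho> * (x \<bullet> x)"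
      proof (rule mult_right_mono)
        have "c \<le> \<rho> * d / trace (Mt S)"
          unfolding c_def using tr(2) pos \<rho>d by (intro divide_left_mono) auto
        then show "c \<le> d / trace (Mt S) * \<rho>" by (simp add: mult.commute)
      qed simp
      \<comment> \<open>The form of \<open>F S\<close> is nonnegative and
        \<open>\<rho> \<le> 1\<close>, so adding its share only increases the value.\<close>
      also have "\<dots> \<le> d / trace (Mt S) * ((1 - \<rho>) * (x \<bullet> (F S *v x)) + \<rho> * (x \<bullet> x))"
        using F_nonneg[OF D[OF S], of x] assms(6) d pos
        by (subst mult.assoc, intro mult_left_mono) auto
      also have "\<dots> = x \<bullet> (M S *v x)"
        by (simp add: M Mt matrix_vector_mult_add_rdistrib scaleR_matrix_vector_assoc[symmetric]
            inner_add_right)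
      finally show ?thesis .
    qed
    moreover have "trace (M S) = d" using pos by (simp add: M trace_scaleR)
    moreover have "transpose (M S) = M S"
      by (simp add: M Mt transpose_scalar transpose_add F_sym transpose_mat)
    ultimately show "M S \<in> ?D" by (simp add: spd_slice_def)
  qed
  ultimately obtain S where "S \<in> ?D" "M S = S"
    using brouwer[OF compact_spd_slice[OF c(1)] convex_spd_slice] by metis
  then show ?thesis using D n unfolding M_def by auto
qed

end
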